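(* Let $g(t)=(e^t+1)^{-1}$. Then for every integer $n\geq 0$, $$g^{(n)}(0)=\frac{1-2^{n+1}}{n+1}B_{n+1},$$ where $B_n$ is the $n$-th Bernoulli number.
   Context: $g^{(n)}(0)$ denotes the $n$-th derivative of $g$ at $0$ (with $g^{(0)}=g$). The Bernoulli numbers $B_n$ are defined by the generating function $\dfrac{t}{e^t-1}=\sum_{n=0}^\infty \dfrac{B_n}{n!}t^n$ (so $B_1=-\tfrac12$). *)

theory Defs
  imports "HOL-Analysis.Analysis"
begin

text \<open>
  The exponential generating function is taken as a formal power series. The divisor
  \<open>fps_exp 1 - 1\<close> is not a unit (it has subdegree 1); division of formal power series
  cancels the common factor \<open>fps_X\<close>, as \<open>bernoulli_egf\<close> confirms.
\<close>

definition bernoulli :: "nat \<Rightarrow> real" where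
  "bernoulli n = fact n * fps_nth (fps_X / (fps_exp 1 - 1)) n"

lemma bernoulli_egf:
  "Abs_fps (\<lambda>n. bernoulli n / fact n) * (fps_exp 1 - 1) = fps_X"
proof -
  have sub: "subdegree (fps_exp 1 - 1 :: real fps) = 1"
    by (rule subdegreeI) auto
  hence "(fps_exp 1 - 1 :: real fps) dvd fps_X"
    by (subst fps_dvd_iff) (auto)
  moreover have "Abs_fps (\<lambda>n. bernoulli n / fact n) = fps_X / (fps_exp 1 - 1)"
    by (simp add: fps_eq_iff bernoulli_def)
  ultimately show ?thesis by simp
qed

lemma bernoulli_1: "bernoulli 1 = - 1 / 2"
proof -
  have "bernoulli 0 = 1"
    using arg_cong[OF bernoulli_egf, of "\<lambda>f. fps_nth f 1"]
    by (simp add: fps_mult_nth)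
  thus ?thesis
    using arg_cong[OF bernoulli_egf, of "\<lambda>f. fps_nth f 2"]
    by (simp add: fps_mult_nth numeral_2_eq_2)
qed

end

theory Submission
  imports Defs
begin

text \<open>
  The reason behind the formula is the partial fraction identity
  \<open>1 / (e^t + 1) = 1 / (e^t - 1) - 2 / (e^(2 t) - 1)\<close>. Multiplied by \<open>t\<close>, it says that
  \<open>t g(t) = B(t) - B(2 t)\<close>, where \<open>B(t) = t / (e^t - 1)\<close> is the generating function of the
  Bernoulli numbers. Comparing the coefficients of \<open>t^(n + 1)\<close> shows that the \<open>n\<close>-th Taylor
  coefficient of \<open>g\<close> is \<open>(1 - 2^(n + 1)) B\<^sub>n\<^sub>+\<^sub>1 / (n + 1)!\<close>, and the derivative is \<open>n!\<close> times that.

  The identity is proved for formal power series (\<open>fps_X_mult_inverse_exp_plus_1\<close>), where the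
  factor \<open>t\<close> has removed the poles of the individual fractions at \<open>0\<close>. The passage to
  derivatives of the actual function is \<open>has_fps_expansion_imp_higher_deriv_at_0\<close>: a function that
  agrees near \<open>0\<close> with a convergent power series has the derivatives which the series prescribes.
\<close>

text \<open>
  Differentiating term by term \<open>n\<close> times leaves a series for the \<open>n\<close>-th derivative, so induction
  on \<open>n\<close> with the function and the series generalised reduces the claim to the value at \<open>0\<close>.
\<close>

lemma has_fps_expansion_imp_higher_deriv_at_0:
  fixes f :: "'a :: {banach, real_normed_field} \<Rightarrow> 'a"
  assumes "f has_fps_expansion F"
  shows "(deriv ^^ n) f 0 = fact n * fps_nth F n"
  using assms
proof (induction n arbitrary: f F)
  case 0
  then have "eventually (\<lambda>z. eval_fps F z = f z) (nhds 0)"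
    by (simp add: has_fps_expansion_def)
  then have "eval_fps F 0 = f 0"
    by (rule eventually_nhds_x_imp_x)
  then show ?case
    by (simp add: eval_fps_at_0)
next
  case (Suc n)
  have "(deriv ^^ Suc n) f 0 = (deriv ^^ n) (deriv f) 0"
    by (simp add: funpow_Suc_right del: funpow.simps)
  also have "\<dots> = fact n * fps_nth (fps_deriv F) n"
    by (rule Suc.IH) (rule has_fps_expansion_deriv [OF Suc.prems])
  finally show ?case
    by (simp add: algebra_simps)
qed

abbreviation bernoulli_fps :: "real fps" where
  "bernoulli_fps \<equiv> Abs_fps (\<lambda>n. bernoulli n / fact n)"

text \<open>
  Substituting \<open>2 t\<close> in \<open>B(t) (e^t - 1) = t\<close> and factoring \<open>e^(2 t) - 1 = (e^t - 1) (e^t + 1)\<close>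
  gives \<open>B(2 t) (e^t + 1) (e^t - 1) = 2 t = 2 B(t) (e^t - 1)\<close>; then \<open>e^t - 1\<close> cancels.
\<close>

lemma bernoulli_fps_duplication:
  "(bernoulli_fps oo (fps_const 2 * fps_X)) * (fps_exp 1 + 1) = 2 * bernoulli_fps"
proof -
  let ?D = "bernoulli_fps oo (fps_const 2 * fps_X)"
  let ?E = "fps_exp 1 :: real fps"
  have square: "?E * ?E = fps_exp 2"
    using fps_exp_add_mult [of "1 :: real" 1] by simp
  have "fps_nth (?E - 1) 1 \<noteq> 0"
    by simp
  then have nonzero: "?E - 1 \<noteq> 0"
    by (metis fps_zero_nth)
  have "?D * ((?E oo (fps_const 2 * fps_X)) - 1) = fps_const 2 * fps_X"
    using arg_cong [OF bernoulli_egf, of "\<lambda>F. F oo (fps_const 2 * fps_X)"]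
    by (simp add: fps_compose_mult_distrib fps_compose_sub_distrib)
  then have "?D * (?E * ?E - 1) = 2 * fps_X"
    by (simp add: square numeral_fps_const)
  then have "?D * (?E * ?E - 1) = 2 * (bernoulli_fps * (?E - 1))"
    by (simp only: bernoulli_egf)
  then have "(?D * (?E + 1)) * (?E - 1) = (2 * bernoulli_fps) * (?E - 1)"
    by (simp add: algebra_simps)
  with nonzero show ?thesis
    by (simp only: mult_cancel_right) simp
qed

text \<open>The identity \<open>t / (e^t + 1) = B(t) - B(2 t)\<close>, checked after multiplication by \<open>e^t + 1\<close>.\<close>

lemma fps_X_mult_inverse_exp_plus_1:
  "fps_X * inverse (fps_exp 1 + 1 :: real fps) =
     bernoulli_fps - (bernoulli_fps oo (fps_const 2 * fps_X))"
proof -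
  let ?D = "bernoulli_fps oo (fps_const 2 * fps_X)"
  let ?E = "fps_exp 1 :: real fps"
  have const: "fps_nth (?E + 1) 0 \<noteq> 0"
    by simp
  then have nonzero: "?E + 1 \<noteq> 0"
    by (metis fps_zero_nth)
  have "(fps_X * inverse (?E + 1)) * (?E + 1) = fps_X"
    using inverse_mult_eq_1 [OF const] by (simp only: mult.assoc mult_1_right)
  also have "fps_X = bernoulli_fps * (?E + 1) - 2 * bernoulli_fps"
    by (subst bernoulli_egf [symmetric]) (simp add: algebra_simps)
  also have "\<dots> = (bernoulli_fps - ?D) * (?E + 1)"
    by (simp only: bernoulli_fps_duplication left_diff_distrib)
  finally show ?thesis
    using nonzero by (simp only: mult_cancel_right) simp
qed

lemma fps_nth_inverse_exp_plus_1:
  "fps_nth (inverse (fps_exp 1 + 1 :: real fps)) n =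
     (1 - 2 ^ (n + 1)) * bernoulli (n + 1) / fact (n + 1)"
proof -
  have "fps_nth (inverse (fps_exp 1 + 1 :: real fps)) n =
          fps_nth (fps_X * inverse (fps_exp 1 + 1 :: real fps)) (n + 1)"
    by simp
  also have "\<dots> = bernoulli (n + 1) / fact (n + 1)
                  - 2 ^ (n + 1) * (bernoulli (n + 1) / fact (n + 1))"
    unfolding fps_X_mult_inverse_exp_plus_1 by (simp add: fps_compose_linear del: fact_Suc)
  finally show ?thesis
    by (simp add: left_diff_distrib diff_divide_distrib del: fact_Suc)
qed

theorem theorem3:
  fixes g :: "real \<Rightarrow> real" and n :: nat
  defines "g \<equiv> (\<lambda>t. inverse (exp t + 1))"
  shows "(deriv ^^ n) g 0 = (1 - 2 ^ (n + 1)) / real (n + 1) * bernoulli (n + 1)"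
proof -
  have "g has_fps_expansion inverse (fps_exp 1 + 1)"
    unfolding g_def
    by (intro has_fps_expansion_inverse has_fps_expansion_add has_fps_expansion_exp1
        has_fps_expansion_1) simp
  then have "(deriv ^^ n) g 0 =
      fact n * ((1 - 2 ^ (n + 1)) * bernoulli (n + 1) / fact (n + 1))"
    by (simp only: has_fps_expansion_imp_higher_deriv_at_0 fps_nth_inverse_exp_plus_1)
  also have "\<dots> = (1 - 2 ^ (n + 1)) / real (n + 1) * bernoulli (n + 1)"
    by (simp add: divide_simps)
  finally show ?thesis .
qed

end
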